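(* Let $f:\mathbb{R}^n\to\mathbb{R}$ be convex and differentiable with $L$-Lipschitz continuous gradient ($L>0$), let $g:\mathbb{R}^n\to\mathbb{R}\cup\{+\infty\}$ be proper, lower semicontinuous and convex, let $F=f+g$, and suppose $\min F>-\infty$. Suppose there is $\nu>0$ such that for all $x\in\mathbb{R}^n$, $$F(x)-\min F\ge\nu\|x-\overline{x}\|^2,$$ where $\overline{x}$ is the projection of $x$ onto $\arg\min F$. Let $(\beta_k)_{k\ge 0}\subseteq[0,1)$ be non-increasing with $0<\inf_k\beta_k\le\beta_k\le\beta_0<1$, fix $0<c<1$, and set $\gamma_k=\frac{2(1-\beta_k)c}{L}$. Let $(x^k)_{k\ge 0}$ be generated by the proximal inertial gradient descent $$x^{k+1}=\mathbf{prox}_{\gamma_k g}\left[x^k-\gamma_k\nabla f(x^k)+\beta_k(x^k-x^{k-1})\right],\qquad k\ge 1,$$ from given initial points $x^0,x^1\in\mathbb{R}^n$. Then there is $\omega\in(0,1)$ such that $$F(x^k)-\min F=O(\omega^k)\quad\text{as }k\to\infty.$$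
   Context: $\|\cdot\|$ is the Euclidean norm; $\mathbf{prox}_{\gamma g}(y)=\arg\min_z\{g(z)+\frac{1}{2\gamma}\|z-y\|^2\}$. $\min F$ denotes the minimum value of $F$, attained on the nonempty (closed convex) set $\arg\min F$. *)

theory Defs
  imports "HOL-Analysis.Analysis" "HOL-Library.Landau_Symbols"
begin

definition proper_fun :: "('a \<Rightarrow> ereal) \<Rightarrow> bool" where
  "proper_fun g \<longleftrightarrow> (\<forall>x. g x \<noteq> -\<infinity>) \<and> (\<exists>x. g x \<noteq> \<infinity>)"

text \<open>The limit inferior is taken along the punctured neighbourhood filter; including
  the point itself would give an equivalent condition.\<close>

definition lsc_fun :: "('a::topological_space \<Rightarrow> ereal) \<Rightarrow> bool" where
  "lsc_fun g \<longleftrightarrow> (\<forall>x. g x \<le> Liminf (at x) g)"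

text \<open>Meant for functions that avoid the value \<open>-\<infinity>\<close>. Since \<open>0 * \<infinity> = 0\<close> in
  \<^typ>\<open>ereal\<close>, the inequality is trivial at \<open>t = 0\<close> and \<open>t = 1\<close>.\<close>

definition convex_fun :: "('a::real_vector \<Rightarrow> ereal) \<Rightarrow> bool" where
  "convex_fun g \<longleftrightarrow>
    (\<forall>x y. \<forall>t\<in>{0..1::real}.
      g ((1 - t) *\<^sub>R x + t *\<^sub>R y) \<le> ereal (1 - t) * g x + ereal t * g y)"

definition argmin_set :: "('a \<Rightarrow> ereal) \<Rightarrow> 'a set" where
  "argmin_set F = {x. is_arg_min F (\<lambda>_. True) x}"

definition min_value :: "('a \<Rightarrow> ereal) \<Rightarrow> ereal" where
  "min_value F = (INF x. F x)"

text \<open>For \<open>\<gamma> > 0\<close> and \<open>g\<close> proper, lower semicontinuous and convex on a Euclidean space,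
  the minimizer exists and is unique, so the choice made by \<^const>\<open>arg_min\<close> is determined.\<close>

definition prox :: "real \<Rightarrow> ('a::real_normed_vector \<Rightarrow> ereal) \<Rightarrow> 'a \<Rightarrow> 'a" where
  "prox \<gamma> g y = (ARG_MIN (\<lambda>z. g z + ereal (1 / (2 * \<gamma>) * (norm (z - y))\<^sup>2)) z. True)"

end

theory Submission imports Defs begin

text \<open>
  With \<open>\<Delta>\<^sub>k = x\<^sub>k - x\<^sub>k\<^sub>-\<^sub>1\<close>, the energy
  \<open>\<xi>\<^sub>k = F(x\<^sub>k) - min F + \<delta>\<^sub>k \<parallel>\<Delta>\<^sub>k\<parallel>\<^sup>2\<close>, \<open>\<delta>\<^sub>k = \<beta>\<^sub>k / (2 \<gamma>\<^sub>k)\<close>, loses at least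
  \<open>\<eta> \<parallel>\<Delta>\<^sub>k\<^sub>+\<^sub>1\<parallel>\<^sup>2\<close> in each step: this is the descent lemma together with the variational
  inequality of the prox step tested at \<open>x\<^sub>k\<close>. Testing the same inequality at the projection of
  \<open>x\<^sub>k\<^sub>+\<^sub>1\<close> onto the minimizers and absorbing the distance by quadratic growth bounds
  \<open>F(x\<^sub>k\<^sub>+\<^sub>1) - min F\<close> by a multiple of \<open>\<parallel>\<Delta>\<^sub>k\<^sub>+\<^sub>1\<parallel>\<^sup>2 + \<parallel>\<Delta>\<^sub>k\<parallel>\<^sup>2\<close>. Hence
  \<open>\<xi>\<^sub>k\<^sub>+\<^sub>1 \<le> K (\<xi>\<^sub>k\<^sub>-\<^sub>1 - \<xi>\<^sub>k\<^sub>+\<^sub>1)\<close>, a linear rate over two steps.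
\<close>

section \<open>Lower semicontinuity and attainment of minima on compact sets\<close>

lemma lsc_funD:
  assumes "lsc_fun g" "a < g x"
  shows "eventually (\<lambda>y. a < g y) (nhds x)"
proof -
  have "a < Liminf (at x) g"
    using assms unfolding lsc_fun_def by (meson less_le_trans)
  then have "eventually (\<lambda>y. a < g y) (at x)"
    by (rule less_LiminfD)
  then show ?thesis
    using assms(2) by (auto simp: eventually_at_filter elim: eventually_mono)
qed

text \<open>The slack is split: a real \<open>b\<close> strictly between \<open>a - q x\<close> and
  \<open>g x\<close> is a threshold for \<open>g\<close>, and a real \<open>r\<close> between
  \<open>a\<close> and \<open>q x + b\<close> leaves \<open>r - b\<close> as a threshold for the
  continuous \<open>q\<close>.\<close>

lemma eventually_less_continuous_add_lsc:
  fixes g :: "'a::t2_space \<Rightarrow> ereal" and q :: "'a \<Rightarrow> real"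
  assumes lsc: "lsc_fun g" and q: "isCont q x" and less: "a < ereal (q x) + g x"
  shows "eventually (\<lambda>y. a < ereal (q y) + g y) (nhds x)"
proof -
  have "a - ereal (q x) < g x"
    using less by (cases a; cases "g x") auto
  then obtain b where b: "a - ereal (q x) < ereal b" "ereal b < g x"
    using ereal_dense2 by blast
  have "a < ereal (q x + b)"
    using b(1) by (cases a) auto
  then obtain r where r: "a < ereal r" "r < q x + b"
    using ereal_dense2 by (metis less_ereal.simps(1))
  have "filterlim q (nhds (q x)) (nhds x)"
    using q by (simp add: isCont_def tendsto_at_iff_tendsto_nhds)
  then have "eventually (\<lambda>y. r - b < q y) (nhds x)"
    by (rule order_tendstoD(1)) (use r(2) in linarith)
  with lsc_funD[OF lsc b(2)] show ?thesis
  proof eventually_elim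
    case (elim y)
    have "a < ereal r" by (rule r)
    also have "ereal r < ereal (q y) + g y"
      using elim by (cases "g y") auto
    finally show ?case .
  qed
qed

text \<open>Otherwise each \<open>x\<close> has a strictly better point \<open>m x\<close>, and open
  sets \<open>U x\<close> on which \<open>h\<close> exceeds \<open>h (m x)\<close> cover
  \<open>S\<close>. In a finite subcover, the best of the points \<open>m t\<close> lies in some
  \<open>U s\<close>, so \<open>m s\<close> beats it.\<close>

lemma compact_attains_inf_lsc:
  fixes h :: "'a::topological_space \<Rightarrow> 'b::linorder"
  assumes S: "compact S" "S \<noteq> {}"
    and lsc: "\<And>x a. x \<in> S \<Longrightarrow> a < h x \<Longrightarrow> eventually (\<lambda>y. a < h y) (nhds x)"
  shows "\<exists>x\<in>S. \<forall>y\<in>S. h x \<le> h y"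
proof (rule ccontr)
  assume "\<not> ?thesis"
  then have "\<forall>x\<in>S. \<exists>y\<in>S. h y < h x" by (force simp: not_le)
  then obtain m where m: "\<And>x. x \<in> S \<Longrightarrow> m x \<in> S \<and> h (m x) < h x" by metis
  have "\<forall>x\<in>S. \<exists>U. open U \<and> x \<in> U \<and> (\<forall>y\<in>U. h (m x) < h y)"
    using lsc m by (fastforce simp: eventually_nhds)
  then obtain U where U: "\<And>x. x \<in> S \<Longrightarrow> open (U x) \<and> x \<in> U x \<and> (\<forall>y\<in>U x. h (m x) < h y)"
    by metis
  obtain T where T: "T \<subseteq> S" "finite T" "S \<subseteq> (\<Union>x\<in>T. U x)"
    using S(1) U by (elim compactE_image[of S S U]) auto
  have "T \<noteq> {}" using T S(2) by auto
  then obtain t where t: "t \<in> T" "\<And>s. s \<in> T \<Longrightarrow> h (m t) \<le> h (m s)"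
    using T(2) ex_min_if_finite[of "(h \<circ> m) ` T"] by (force simp: not_less)
  have "m t \<in> S" using t T m by blast
  then obtain s where s: "s \<in> T" "m t \<in> U s" using T by blast
  then have "h (m s) < h (m t)" using U T by blast
  with t(2)[OF s(1)] show False by simp
qed

section \<open>Optimality conditions and smooth convex functions\<close>

text \<open>Compare \<open>x\<close> with a point a fraction \<open>t\<close> of the way to
  \<open>u\<close>. After division by \<open>t\<close>, convexity of \<open>g\<close> and the bound
  on \<open>\<phi>\<close> give the inequality up to an error linear in \<open>t\<close>, which
  vanishes as \<open>t\<close> tends to 0. An upper bound on \<open>\<phi>\<close> is all that
  enters, so the lemma serves \<open>f\<close>, the concave \<open>-f\<close> and the prox penalty
  alike.\<close>

lemma minimizer_subgradient:
  fixes g :: "'a::real_inner \<Rightarrow> ereal" and \<phi> :: "'a \<Rightarrow> real"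
  assumes g: "proper_fun g" "convex_fun g"
    and min: "\<And>u. ereal (\<phi> x) + g x \<le> ereal (\<phi> u) + g u"
    and upper: "\<And>d. \<phi> (x + d) \<le> \<phi> x + inner v d + M * (norm d)\<^sup>2"
  shows "\<bar>g x\<bar> \<noteq> \<infinity>" "g x \<le> g u + ereal (inner v (u - x))"
proof -
  obtain w where "g w \<noteq> \<infinity>" using g by (auto simp: proper_fun_def)
  moreover have ninf: "g y \<noteq> -\<infinity>" for y using g by (auto simp: proper_fun_def)
  ultimately show fin: "\<bar>g x\<bar> \<noteq> \<infinity>"
    using min[of w] by (cases "g w"; cases "g x") auto
  then obtain a where a: "g x = ereal a" by auto
  show "g x \<le> g u + ereal (inner v (u - x))"
  proof (cases "g u")
    case (real b)
    define d where "d = u - x"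
    have "a - b - inner v d \<le> t * (M * (norm d)\<^sup>2)" if t: "0 < t" "t < 1" for t
    proof -
      have comb: "(1 - t) *\<^sub>R x + t *\<^sub>R u = x + t *\<^sub>R d"
        by (simp add: d_def algebra_simps)
      have "g (x + t *\<^sub>R d) \<le> ereal (1 - t) * g x + ereal t * g u"
        using g(2) t unfolding convex_fun_def comb[symmetric] by auto
      moreover have "ereal (\<phi> x) + g x \<le> ereal (\<phi> (x + t *\<^sub>R d)) + g (x + t *\<^sub>R d)"
        by (rule min)
      ultimately have "\<phi> x + a \<le> \<phi> (x + t *\<^sub>R d) + ((1 - t) * a + t * b)"
        using ninf[of "x + t *\<^sub>R d"] a real by (cases "g (x + t *\<^sub>R d)") auto
      with upper[of "t *\<^sub>R d"]
      have "t * (a - b - inner v d) \<le> t * (t * (M * (norm d)\<^sup>2))"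
        by (simp add: algebra_simps power2_eq_square)
      then show ?thesis using t by simp
    qed
    then have "eventually (\<lambda>t. a - b - inner v d \<le> t * (M * (norm d)\<^sup>2)) (at_right 0)"
      unfolding eventually_at_right[OF zero_less_one] by (intro exI[of _ 1]) simp
    moreover have "((\<lambda>t. t * (M * (norm d)\<^sup>2)) \<longlongrightarrow> 0 * (M * (norm d)\<^sup>2)) (at_right 0)"
      by (intro tendsto_intros)
    ultimately have "a - b - inner v d \<le> 0"
      by (metis mult_zero_left tendsto_lowerbound trivial_limit_at_right_real)
    then show ?thesis using a real by (simp add: d_def)
  qed (use a ninf in auto)
qed

text \<open>The descent lemma: \<open>\<phi>\<close> is \<open>f\<close> along the segment minus the
  quadratic model, up to a constant. Cauchy-Schwarz and the Lipschitz bound make its derivative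
  nonpositive on [0,1].\<close>

lemma lipschitz_gradient_upper_bound:
  fixes f :: "'a::real_inner \<Rightarrow> real"
  assumes grad: "\<And>y. GDERIV f y :> G y" and lip: "L-lipschitz_on UNIV G"
  shows "f (x + d) \<le> f x + inner (G x) d + L / 2 * (norm d)\<^sup>2"
proof -
  define \<phi> where "\<phi> t = f (x + t *\<^sub>R d) - t * inner (G x) d - L / 2 * t\<^sup>2 * (norm d)\<^sup>2" for t
  have der: "(\<phi> has_real_derivative
      (inner (G (x + t *\<^sub>R d) - G x) d - L * t * (norm d)\<^sup>2)) (at t)" for t
  proof -
    have "(f has_derivative (\<lambda>h. inner h (G (x + t *\<^sub>R d)))) (at (x + t *\<^sub>R d))"
      using grad unfolding gderiv_def by blast
    moreover have "((\<lambda>t. x + t *\<^sub>R d) has_derivative (\<lambda>s. s *\<^sub>R d)) (at t)"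
      by (auto intro!: derivative_eq_intros)
    ultimately have "((\<lambda>t. f (x + t *\<^sub>R d)) has_derivative
        (\<lambda>s. inner (s *\<^sub>R d) (G (x + t *\<^sub>R d)))) (at t)"
      using has_derivative_compose by blast
    then have "((\<lambda>t. f (x + t *\<^sub>R d)) has_real_derivative inner (G (x + t *\<^sub>R d)) d) (at t)"
      by (simp add: has_field_derivative_def inner_commute mult.commute[of _ "inner _ _"])
    then show ?thesis
      unfolding \<phi>_def
      by (auto intro!: derivative_eq_intros simp: algebra_simps)
  qed
  have "\<phi> 1 \<le> \<phi> 0"
  proof (rule DERIV_nonpos_imp_nonincreasing[where f = \<phi>])
    fix t :: real assume t: "0 \<le> t" "t \<le> 1"
    have "inner (G (x + t *\<^sub>R d) - G x) d \<le> norm (G (x + t *\<^sub>R d) - G x) * norm d"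
      by (rule norm_cauchy_schwarz)
    also have "\<dots> \<le> L * norm (t *\<^sub>R d) * norm d"
      using lipschitz_onD[OF lip, of "x + t *\<^sub>R d" x]
      by (intro mult_right_mono) (auto simp: dist_norm)
    finally have "inner (G (x + t *\<^sub>R d) - G x) d - L * t * (norm d)\<^sup>2 \<le> 0"
      using t by (simp add: power2_eq_square)
    then show "\<exists>y. (\<phi> has_real_derivative y) (at t) \<and> y \<le> 0" using der by blast
  qed simp
  then show ?thesis by (simp add: \<phi>_def)
qed

text \<open>The tangent inequality is the optimality condition of any point for \<open>(-f) + f\<close>.\<close>

lemma convex_lipschitz_gradient_tangent:
  fixes f :: "'a::real_inner \<Rightarrow> real"
  assumes conv: "convex_on UNIV f" and grad: "\<And>y. GDERIV f y :> G y"
    and lip: "L-lipschitz_on UNIV G"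
  shows "f x \<le> f u + inner (G x) (x - u)"
proof -
  have neg: "GDERIV (\<lambda>y. - f y) y :> - G y" for y
    using grad[of y] by (rule GDERIV_minus)
  have "ereal (f x) \<le> ereal (f u) + ereal (inner (- G x) (u - x))"
  proof (rule minimizer_subgradient(2)[where \<phi> = "\<lambda>y. - f y"])
    show "proper_fun (\<lambda>y. ereal (f y))" by (simp add: proper_fun_def)
    show "convex_fun (\<lambda>y. ereal (f y))"
      using conv by (auto simp: convex_fun_def convex_on_def)
    show "- f (x + d) \<le> - f x + inner (- G x) d + L / 2 * (norm d)\<^sup>2" for d
      by (rule lipschitz_gradient_upper_bound[OF neg])
        (use lip in \<open>simp add: lipschitz_on_def dist_minus\<close>)
  qed simp
  then show ?thesis by (simp add: inner_diff_right)
qed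

section \<open>Existence and variational inequality of the proximal map\<close>

lemma norm_sq_shift_expand:
  fixes x y d :: "'a::real_inner"
  shows "(norm (x + d - y))\<^sup>2 = (norm (x - y))\<^sup>2 + 2 * inner (x - y) d + (norm d)\<^sup>2"
  unfolding power2_norm_eq_inner by (simp add: algebra_simps inner_commute)

text \<open>Existence of the prox needs an affine minorant of \<open>g\<close>; here it is given by a subgradient
  \<open>-v\<close> at some point \<open>z\<close>.\<close>

lemma prox_minimizes:
  fixes g :: "'a::euclidean_space \<Rightarrow> ereal"
  assumes lsc: "lsc_fun g" and \<gamma>: "\<gamma> > 0"
    and minorant: "\<And>u. g z \<le> g u + ereal (inner v (u - z))"
  shows "ereal (1 / (2 * \<gamma>) * (norm (prox \<gamma> g y - y))\<^sup>2) + g (prox \<gamma> g y)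
    \<le> ereal (1 / (2 * \<gamma>) * (norm (u - y))\<^sup>2) + g u"
proof -
  define q where "q u = 1 / (2 * \<gamma>) * (norm (u - y))\<^sup>2" for u
  define h where "h u = ereal (q u) + g u" for u
  \<comment> \<open>\<open>w\<close> collects the linear terms: with \<open>d = u - z\<close>, the
    minorant gives that \<open>h u - h z\<close> is at least
    \<open>(norm d)\<^sup>2 / (2 * \<gamma>) - inner w d\<close>. This is nonnegative once
    \<open>norm d\<close> reaches \<open>R\<close>, so minimizing over the ball suffices.\<close>
  define w where "w = v - (1 / \<gamma>) *\<^sub>R (z - y)"
  define R where "R = 2 * \<gamma> * norm w"
  have "R \<ge> 0" using \<gamma> by (simp add: R_def)
  have q_cont: "isCont q u" for u
    unfolding q_def by (intro continuous_intros)
  have "\<exists>p\<in>cball z R. \<forall>u\<in>cball z R. h p \<le> h u"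
    unfolding h_def
    by (rule compact_attains_inf_lsc)
      (use \<open>R \<ge> 0\<close> eventually_less_continuous_add_lsc[OF lsc q_cont] in auto)
  then obtain p where p: "\<And>u. u \<in> cball z R \<Longrightarrow> h p \<le> h u" by blast
  have outside: "h z \<le> h u" if "u \<notin> cball z R" for u
  proof -
    define d where "d = u - z"
    have "R < norm d" using that by (simp add: d_def dist_norm norm_minus_commute)
    have "inner w d \<le> norm w * norm d" by (rule norm_cauchy_schwarz)
    also have "\<dots> = 1 / (2 * \<gamma>) * (R * norm d)" using \<gamma> by (simp add: R_def)
    also have "\<dots> \<le> 1 / (2 * \<gamma>) * (norm d)\<^sup>2"
      unfolding power2_eq_square
      using \<gamma> \<open>R < norm d\<close> by (intro mult_left_mono mult_right_mono) auto
    finally have "inner v d \<le> inner (z - y) d / \<gamma> + 1 / (2 * \<gamma>) * (norm d)\<^sup>2"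
      by (simp add: w_def inner_diff_left)
    moreover have "q u = q z + inner (z - y) d / \<gamma> + 1 / (2 * \<gamma>) * (norm d)\<^sup>2"
      using norm_sq_shift_expand[of z d y] \<gamma> by (simp add: q_def d_def field_simps)
    ultimately have "q z + inner v d \<le> q u" by simp
    moreover have "g z \<le> g u + ereal (inner v d)" using minorant by (simp add: d_def)
    ultimately show ?thesis
      unfolding h_def by (cases "g z"; cases "g u") auto
  qed
  have "h p \<le> h u" for u
    using p outside \<open>R \<ge> 0\<close> by (meson centre_in_cball order_trans)
  \<comment> \<open>\<open>arg_min\<close> is a choice operator: the existence of the minimizer
    \<open>p\<close> is what makes the chosen point a minimizer.\<close>
  then have "is_arg_min h (\<lambda>_. True) p" by (simp add: is_arg_min_linorder)
  then have "is_arg_min h (\<lambda>_. True) (arg_min h (\<lambda>_. True))"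
    unfolding arg_min_def by (rule someI)
  moreover have "arg_min h (\<lambda>_. True) = prox \<gamma> g y"
    unfolding prox_def h_def q_def by (simp add: add.commute)
  ultimately have "h (prox \<gamma> g y) \<le> h u" by (simp add: is_arg_min_linorder)
  then show ?thesis by (simp add: h_def q_def)
qed

text \<open>This is \<open>minimizer_subgradient\<close> with the prox penalty as
  \<open>\<phi>\<close>. The quadratic bound on the penalty is an exact expansion, with gradient
  \<open>(prox \<gamma> g y - y) / \<gamma>\<close> at the minimizer.\<close>

lemma prox_subgradient:
  fixes g :: "'a::euclidean_space \<Rightarrow> ereal"
  assumes g: "proper_fun g" "lsc_fun g" "convex_fun g" and \<gamma>: "\<gamma> > 0"
    and minorant: "\<And>u. g z \<le> g u + ereal (inner v (u - z))"
  shows "\<bar>g (prox \<gamma> g y)\<bar> \<noteq> \<infinity>"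
    "g (prox \<gamma> g y) \<le> g u + ereal (inner (prox \<gamma> g y - y) (u - prox \<gamma> g y) / \<gamma>)"
proof -
  let ?q = "\<lambda>u. 1 / (2 * \<gamma>) * (norm (u - y))\<^sup>2" and ?p = "prox \<gamma> g y"
  note min = prox_minimizes[OF g(2) \<gamma> minorant]
  have up: "?q (?p + d) \<le> ?q ?p + inner ((1 / \<gamma>) *\<^sub>R (?p - y)) d + 1 / (2 * \<gamma>) * (norm d)\<^sup>2" for d
    using norm_sq_shift_expand[of ?p d y] \<gamma> unfolding inner_scaleR_left by (simp add: field_simps)
  show "\<bar>g ?p\<bar> \<noteq> \<infinity>"
    by (rule minimizer_subgradient(1)[OF g(1,3), where \<phi> = ?q]) (rule min, rule up)
  have "g ?p \<le> g u + ereal (inner ((1 / \<gamma>) *\<^sub>R (?p - y)) (u - ?p))"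
    by (rule minimizer_subgradient(2)[OF g(1,3), where \<phi> = ?q]) (rule min, rule up)
  then show "g ?p \<le> g u + ereal (inner (?p - y) (u - ?p) / \<gamma>)" by simp
qed

section \<open>Geometric decay of real sequences\<close>

lemma two_step_linear_rate:
  fixes a :: "nat \<Rightarrow> real"
  assumes q: "q > 0" and nonneg: "\<And>k. k \<ge> m \<Longrightarrow> a k \<ge> 0"
    and step: "\<And>k. k \<ge> m \<Longrightarrow> a (k + 2) \<le> q * a k"
  shows "a \<in> O(\<lambda>k. sqrt q ^ k)"
proof -
  define \<omega> where "\<omega> = sqrt q"
  have \<omega>: "\<omega> > 0" "\<omega>\<^sup>2 = q" using q by (auto simp: \<omega>_def)
  \<comment> \<open>The recursion links indices of equal parity only, so \<open>A\<close> must cover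
    both starting values, at \<open>m\<close> and at \<open>m + 1\<close>.\<close>
  define A where "A = max (a m / \<omega> ^ m) (a (m + 1) / \<omega> ^ (m + 1))"
  have bound: "a (m + j) \<le> A * \<omega> ^ (m + j)" for j
  proof (induction j rule: less_induct)
    case (less j)
    consider "j = 0" | "j = 1" | i where "j = i + 2"
      by (metis One_nat_def add_2_eq_Suc' not0_implies_Suc)
    then show ?case
    proof cases
      case 1
      have "a m / \<omega> ^ m \<le> A" by (simp add: A_def)
      then show ?thesis using \<omega> 1 by (simp add: pos_divide_le_eq)
    next
      case 2
      have "a (m + 1) / \<omega> ^ (m + 1) \<le> A" by (simp add: A_def)
      then show ?thesis using \<omega> 2 by (simp add: pos_divide_le_eq)
    next
      case (3 i)
      have "a (m + j) \<le> q * a (m + i)" using step[of "m + i"] 3 by (simp add: add.assoc)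
      also have "\<dots> \<le> q * (A * \<omega> ^ (m + i))"
        using less[of i] 3 q by (intro mult_left_mono) auto
      also have "\<dots> = A * \<omega> ^ (m + j)"
        unfolding 3 \<omega>(2)[symmetric] by (simp add: power_add power2_eq_square mult_ac)
      finally show ?thesis .
    qed
  qed
  have "a k \<le> A * \<omega> ^ k" if "k \<ge> m" for k
    using bound[of "k - m"] that by simp
  then have "eventually (\<lambda>k. norm (a k) \<le> A * norm (\<omega> ^ k)) sequentially"
    using nonneg \<omega>(1) by (intro eventually_sequentiallyI[of m]) auto
  then show ?thesis unfolding \<omega>_def by (rule bigoI)
qed

theorem theorem3:
  fixes f :: "real ^ 'n \<Rightarrow> real"
    and grad_f :: "real ^ 'n \<Rightarrow> real ^ 'n"
    and g F :: "real ^ 'n \<Rightarrow> ereal"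
    and L \<nu> c :: real
    and \<beta> \<gamma> :: "nat \<Rightarrow> real"
    and x :: "nat \<Rightarrow> real ^ 'n"
  assumes f_convex: "convex_on UNIV f"
    and f_grad: "\<And>y. GDERIV f y :> grad_f y"
    and L_pos: "L > 0"
    and grad_lipschitz: "L-lipschitz_on UNIV grad_f"
    and g_proper: "proper_fun g"
    and g_lsc: "lsc_fun g"
    and g_convex: "convex_fun g"
    and F_eq: "F = (\<lambda>y. ereal (f y) + g y)"
    and min_attained: "argmin_set F \<noteq> {}"
    and min_bounded: "min_value F > -\<infinity>"
    and \<nu>_pos: "\<nu> > 0"
    and growth: "\<And>y. F y - min_value F \<ge>
                   ereal (\<nu> * (norm (y - closest_point (argmin_set F) y))\<^sup>2)"
    and \<beta>_range: "\<And>k. \<beta> k \<in> {0..<1}"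
    and \<beta>_mono: "decseq \<beta>"
    and \<beta>_inf: "(INF k. \<beta> k) > 0"
    and c_range: "0 < c" "c < 1"
    and \<gamma>_eq: "\<And>k. \<gamma> k = 2 * (1 - \<beta> k) * c / L"
    and iteration: "\<And>k. k \<ge> 1 \<Longrightarrow>
          x (k + 1) = prox (\<gamma> k) g (x k - \<gamma> k *\<^sub>R grad_f (x k) + \<beta> k *\<^sub>R (x k - x (k - 1)))"
  shows "\<exists>\<omega>\<in>{0<..<1::real}.
           (\<forall>\<^sub>F k in sequentially. \<bar>F (x k)\<bar> \<noteq> \<infinity>) \<and>
           (\<lambda>k. real_of_ereal (F (x k) - min_value F)) \<in> O(\<lambda>k. \<omega> ^ k)"
proof -

  \<comment> \<open>Step sizes and energy weights\<close>
  define D where "D k = x k - x (k - 1)" for k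
  define \<delta> where "\<delta> k = \<beta> k / (2 * \<gamma> k)" for k
  \<comment> \<open>The surplus of \<open>L / (2 * c)\<close> over the curvature term
    \<open>L / 2\<close> of the descent lemma; it is positive because \<open>c < 1\<close>.\<close>
  define \<eta> where "\<eta> = L / (2 * c) - L / 2"
  have \<beta>: "0 \<le> \<beta> k" "\<beta> k < 1" for k using \<beta>_range[of k] by auto
  have \<gamma>_pos: "\<gamma> k > 0" for k using \<beta>[of k] L_pos c_range by (simp add: \<gamma>_eq)
  have \<gamma>_ge: "\<gamma> 0 \<le> \<gamma> k" for k
    using decseqD[OF \<beta>_mono, of 0 k] L_pos c_range
    by (auto simp: \<gamma>_eq intro!: divide_right_mono mult_right_mono)
  have \<gamma>_mono: "\<gamma> k \<le> \<gamma> (Suc k)" for k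
    using decseqD[OF \<beta>_mono, of k "Suc k"] L_pos c_range
    by (auto simp: \<gamma>_eq intro!: divide_right_mono mult_right_mono)
  \<comment> \<open>The choice of \<open>\<gamma>\<close> makes
    \<open>(1 - \<beta> k) / \<gamma> k\<close> independent of \<open>k\<close>. Of the two copies
    of \<open>\<delta> k\<close>, one will pay for the inertial cross term and the other stays as
    the weight in the energy.\<close>
  have inv_\<gamma>: "1 / \<gamma> k = L / (2 * c) + 2 * \<delta> k" for k
  proof -
    have "1 / \<gamma> k - 2 * \<delta> k = (1 - \<beta> k) / \<gamma> k"
      by (simp add: \<delta>_def diff_divide_distrib)
    also have "\<dots> = L / (2 * c)"
    proof -
      have "b / (2 * b * c / L) = L / (2 * c)" if "b \<noteq> 0" for b
        using that L_pos c_range by (simp add: field_simps)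
      then show ?thesis using \<beta>(2)[of k] by (simp only: \<gamma>_eq)
    qed
    finally show ?thesis by simp
  qed
  have \<eta>_pos: "\<eta> > 0" using L_pos c_range by (simp add: \<eta>_def field_simps)
  have \<delta>_nonneg: "\<delta> k \<ge> 0" for k using \<beta>[of k] \<gamma>_pos[of k] by (simp add: \<delta>_def)
  have \<delta>_Suc: "\<delta> (Suc k) \<le> \<delta> k" for k
    unfolding \<delta>_def using \<beta> \<gamma>_pos[of k] \<gamma>_mono[of k] decseqD[OF \<beta>_mono, of k "Suc k"]
    by (intro frac_le) auto
  have \<delta>_0: "\<delta> k \<le> \<delta> 0" for k
    by (induction k) (use \<delta>_Suc order_trans in blast)+

  \<comment> \<open>The set of minimizers\<close>
  obtain z where z: "z \<in> argmin_set F" using min_attained by blast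
  have argmin_iff: "y \<in> argmin_set F \<longleftrightarrow> F y = F z" for y
    using z by (auto simp: argmin_set_def is_arg_min_linorder intro: antisym)
  have z_min: "ereal (f z) + g z \<le> ereal (f u) + g u" for u
    using z by (simp add: argmin_set_def is_arg_min_linorder F_eq)
  \<comment> \<open>Besides finiteness of \<open>g z\<close>, this yields an affine minorant of
    \<open>g\<close>, on which every later prox step relies.\<close>
  note z_opt = minimizer_subgradient[OF g_proper g_convex z_min
      lipschitz_gradient_upper_bound[OF f_grad grad_lipschitz]]
  obtain m where m: "F z = ereal m"
    using z_opt(1) by (cases "g z") (auto simp: F_eq)
  have min_value: "min_value F = ereal m"
    unfolding min_value_def m[symmetric] using z_min
    by (intro antisym INF_lower INF_greatest) (auto simp: F_eq)
  have f_cont: "isCont f y" for y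
    using f_grad[of y] by (auto simp: gderiv_def intro: has_derivative_continuous)
  \<comment> \<open>Closedness is what guarantees that \<open>closest_point\<close> really lands in
    the set of minimizers.\<close>
  have "open (- argmin_set F)"
    unfolding open_subopen[of "- argmin_set F"]
  proof
    fix y assume "y \<in> - argmin_set F"
    then have "F z < ereal (f y) + g y"
      using z_min[of y] argmin_iff[of y] by (simp add: F_eq less_le)
    then have "eventually (\<lambda>y. F z < F y) (nhds y)"
      unfolding F_eq by (rule eventually_less_continuous_add_lsc[OF g_lsc f_cont])
    then show "\<exists>T. open T \<and> y \<in> T \<and> T \<subseteq> - argmin_set F"
      unfolding eventually_nhds using argmin_iff by fastforce
  qed
  then have closed: "closed (argmin_set F)" by (simp add: closed_def)

  \<comment> \<open>Variational inequality of one iteration\<close>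
  have step: "\<bar>g (x (Suc k))\<bar> \<noteq> \<infinity>"
    "g (x (Suc k)) \<le> g u + ereal (inner (D (Suc k) + \<gamma> k *\<^sub>R grad_f (x k) - \<beta> k *\<^sub>R D k)
      (u - x (Suc k)) / \<gamma> k)" if "k \<ge> 1" for k u
  proof -
    have "x (Suc k) = prox (\<gamma> k) g (x k - \<gamma> k *\<^sub>R grad_f (x k) + \<beta> k *\<^sub>R D k)"
      using iteration[OF that] by (simp add: D_def)
    note prox = prox_subgradient[OF g_proper g_lsc g_convex \<gamma>_pos[of k] z_opt(2),
        where y = "x k - \<gamma> k *\<^sub>R grad_f (x k) + \<beta> k *\<^sub>R D k", folded this]
    show "\<bar>g (x (Suc k))\<bar> \<noteq> \<infinity>" by (rule prox(1))
    show "g (x (Suc k)) \<le> g u + ereal (inner (D (Suc k) + \<gamma> k *\<^sub>R grad_f (x k) - \<beta> k *\<^sub>R D k)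
        (u - x (Suc k)) / \<gamma> k)"
      using prox(2)[of u] by (simp add: D_def algebra_simps)
  qed

  \<comment> \<open>\<open>g\<close> may be infinite at the given points \<open>x 0\<close> and
    \<open>x 1\<close>, where \<open>real_of_ereal\<close> would return 0. The first prox output is
    \<open>x 2\<close>, so facts about \<open>e\<close> start at index 2.\<close>
  define e where "e k = real_of_ereal (F (x k) - min_value F)" for k
  have g_x: "g (x k) = ereal (e k + m - f (x k))" if "k \<ge> 2" for k
  proof -
    obtain j where j: "k = Suc j" "j \<ge> 1"
      using \<open>k \<ge> 2\<close> by (cases k) auto
    obtain b where b: "g (x k) = ereal b"
      using step(1)[OF j(2)] by (auto simp: j(1))
    have "e k = f (x k) + b - m" unfolding e_def min_value by (simp add: F_eq b)
    then show ?thesis by (simp add: b)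
  qed
  then have F_x: "F (x k) = ereal (e k + m)" if "k \<ge> 2" for k
    using that by (simp add: F_eq)
  have e_nonneg: "e k \<ge> 0" if "k \<ge> 2" for k
    using z_min[of "x k"] F_x[OF that] m by (simp add: F_eq)

  \<comment> \<open>Decrease of the energy\<close>
  have descent: "e (Suc k) + (\<delta> k + \<eta>) * (norm (D (Suc k)))\<^sup>2 \<le> e k + \<delta> k * (norm (D k))\<^sup>2"
    if k: "k \<ge> 2" for k
  proof -
    let ?d = "D (Suc k)"
    have D: "x (Suc k) = x k + ?d" "x k - x (Suc k) = - ?d" by (simp_all add: D_def)
    have "f (x (Suc k)) \<le> f (x k) + inner (grad_f (x k)) ?d + L / 2 * (norm ?d)\<^sup>2"
      unfolding D(1) by (rule lipschitz_gradient_upper_bound[OF f_grad grad_lipschitz])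
    moreover have "e (Suc k) - f (x (Suc k)) \<le> e k - f (x k)
        + inner (?d + \<gamma> k *\<^sub>R grad_f (x k) - \<beta> k *\<^sub>R D k) (- ?d) / \<gamma> k"
      using step(2)[of k "x k"] k unfolding D(2) by (simp add: g_x)
    moreover have "inner (?d + \<gamma> k *\<^sub>R grad_f (x k) - \<beta> k *\<^sub>R D k) (- ?d) / \<gamma> k
        = - (1 / \<gamma> k) * (norm ?d)\<^sup>2 - inner (grad_f (x k)) ?d + \<delta> k * (2 * inner (D k) ?d)"
      using \<gamma>_pos[of k] unfolding \<delta>_def power2_norm_eq_inner
      by (simp add: inner_add_left inner_diff_left field_simps)
    \<comment> \<open>Young's inequality splits the inertial cross term evenly between the old and
      the new step.\<close>
    moreover have "\<delta> k * (2 * inner (D k) ?d) \<le> \<delta> k * ((norm (D k))\<^sup>2 + (norm ?d)\<^sup>2)"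
    proof (rule mult_left_mono[OF _ \<delta>_nonneg])
      have "0 \<le> (norm (D k - ?d))\<^sup>2" by simp
      then show "2 * inner (D k) ?d \<le> (norm (D k))\<^sup>2 + (norm ?d)\<^sup>2"
        unfolding power2_norm_eq_inner by (simp add: algebra_simps inner_commute)
    qed
    ultimately have "e (Suc k) \<le> e k + L / 2 * (norm ?d)\<^sup>2
        - (L / (2 * c) + 2 * \<delta> k) * (norm ?d)\<^sup>2 + \<delta> k * ((norm (D k))\<^sup>2 + (norm ?d)\<^sup>2)"
      unfolding inv_\<gamma> by linarith
    then show ?thesis unfolding \<eta>_def by (simp add: algebra_simps)
  qed

  \<comment> \<open>Bounding the optimality gap by step lengths\<close>
  \<comment> \<open>\<open>\<gamma> 0\<close> is the smallest step size, so
    \<open>1 / \<gamma> 0\<close> bounds all \<open>1 / \<gamma> k\<close>.\<close>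
  define C where "C = L + 1 / \<gamma> 0"
  have gap: "e (Suc k) \<le> 2 * C\<^sup>2 / \<nu> * ((norm (D k))\<^sup>2 + (norm (D (Suc k)))\<^sup>2)"
    if k: "k \<ge> 1" for k
  proof -
    let ?y = "x (Suc k)" and ?n = "norm (D k)" and ?n' = "norm (D (Suc k))"
    define u where "u = closest_point (argmin_set F) ?y"
    define d where "d = norm (?y - u)"
    have "u \<in> argmin_set F"
      unfolding u_def using closed min_attained by (rule closest_point_in_set)
    then have "ereal (f u) + g u = ereal m"
      using m argmin_iff[of u] by (simp add: F_eq)
    then have g_u: "g u = ereal (m - f u)"
      by (cases "g u") auto
    have \<nu>_d: "\<nu> * d\<^sup>2 \<le> e (Suc k)"
      using growth[of ?y] k by (simp add: F_x min_value d_def u_def)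
    have "e (Suc k) - f ?y \<le> - f u
        + inner (D (Suc k) + \<gamma> k *\<^sub>R grad_f (x k) - \<beta> k *\<^sub>R D k) (u - ?y) / \<gamma> k"
      using step(2)[of k u] k by (simp add: g_x g_u)
    \<comment> \<open>Taking the tangent at the new iterate leaves only a difference of gradients at
      consecutive iterates, which the Lipschitz bound controls by the step length.\<close>
    moreover have "f ?y \<le> f u + inner (grad_f ?y) (?y - u)"
      by (rule convex_lipschitz_gradient_tangent[OF f_convex f_grad grad_lipschitz])
    moreover have "inner (D (Suc k) + \<gamma> k *\<^sub>R grad_f (x k) - \<beta> k *\<^sub>R D k) (u - ?y) / \<gamma> k
        = - inner (grad_f (x k)) (?y - u) + inner (\<beta> k *\<^sub>R D k - D (Suc k)) (?y - u) / \<gamma> k"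
      using \<gamma>_pos[of k] by (simp add: inner_add_left inner_diff_left inner_diff_right field_simps)
    ultimately have "e (Suc k) \<le> inner (grad_f ?y - grad_f (x k)) (?y - u)
        + inner (\<beta> k *\<^sub>R D k - D (Suc k)) (?y - u) / \<gamma> k"
      by (simp add: inner_diff_left)
    also have "\<dots> \<le> L * (?n + ?n') * d + (?n + ?n') * d / \<gamma> 0"
    proof (rule add_mono)
      have "inner (grad_f ?y - grad_f (x k)) (?y - u) \<le> norm (grad_f ?y - grad_f (x k)) * d"
        unfolding d_def by (rule norm_cauchy_schwarz)
      also have "\<dots> \<le> L * (?n + ?n') * d"
      proof (rule mult_right_mono)
        have "norm (grad_f ?y - grad_f (x k)) \<le> L * ?n'"
          using lipschitz_onD[OF grad_lipschitz, of ?y "x k"] by (simp add: dist_norm D_def)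
        also have "\<dots> \<le> L * (?n + ?n')" using L_pos by (intro mult_left_mono) auto
        finally show "norm (grad_f ?y - grad_f (x k)) \<le> L * (?n + ?n')" .
      qed (simp add: d_def)
      finally show "inner (grad_f ?y - grad_f (x k)) (?y - u) \<le> L * (?n + ?n') * d" .
      have "inner (\<beta> k *\<^sub>R D k - D (Suc k)) (?y - u) \<le> norm (\<beta> k *\<^sub>R D k - D (Suc k)) * d"
        unfolding d_def by (rule norm_cauchy_schwarz)
      also have "\<dots> \<le> (?n + ?n') * d"
      proof (rule mult_right_mono)
        have "\<beta> k * ?n \<le> ?n" using \<beta>[of k] by (intro mult_left_le_one_le) auto
        then show "norm (\<beta> k *\<^sub>R D k - D (Suc k)) \<le> ?n + ?n'"
          using norm_triangle_ineq4[of "\<beta> k *\<^sub>R D k" "D (Suc k)"] \<beta>[of k] by simp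
      qed (simp add: d_def)
      finally show "inner (\<beta> k *\<^sub>R D k - D (Suc k)) (?y - u) / \<gamma> k \<le> (?n + ?n') * d / \<gamma> 0"
        using \<gamma>_pos[of 0] \<gamma>_ge[of k] by (intro frac_le) (auto simp: d_def)
    qed
    also have "\<dots> = C * (?n + ?n') * d" by (simp add: C_def algebra_simps add_divide_distrib)
    \<comment> \<open>Young's inequality weighted by \<open>\<nu>\<close>: quadratic growth bounds
      \<open>\<nu> * d\<^sup>2 / 2\<close> by half of \<open>e (Suc k)\<close>, which is absorbed on
      the left.\<close>
    also have "\<dots> \<le> (C * (?n + ?n'))\<^sup>2 / (2 * \<nu>) + \<nu> * d\<^sup>2 / 2"
    proof -
      have "0 \<le> (C * (?n + ?n') - \<nu> * d)\<^sup>2 / (2 * \<nu>)" using \<nu>_pos by simp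
      also have "\<dots> = (C * (?n + ?n'))\<^sup>2 / (2 * \<nu>) + \<nu> * d\<^sup>2 / 2 - C * (?n + ?n') * d"
        using \<nu>_pos by (simp add: power2_diff field_simps power2_eq_square)
      finally show ?thesis by simp
    qed
    also have "\<dots> \<le> (C * (?n + ?n'))\<^sup>2 / (2 * \<nu>) + e (Suc k) / 2"
      using \<nu>_d by simp
    finally have "e (Suc k) \<le> C\<^sup>2 / \<nu> * (?n + ?n')\<^sup>2"
      by (simp add: power_mult_distrib)
    also have "\<dots> \<le> C\<^sup>2 / \<nu> * (2 * (?n\<^sup>2 + ?n'\<^sup>2))"
    proof (rule mult_left_mono)
      have "0 \<le> (?n - ?n')\<^sup>2" by simp
      then show "(?n + ?n')\<^sup>2 \<le> 2 * (?n\<^sup>2 + ?n'\<^sup>2)"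
        by (simp add: power2_diff power2_sum)
    qed (use \<nu>_pos in simp)
    finally show ?thesis by (simp add: algebra_simps)
  qed

  \<comment> \<open>Two-step contraction of the energy\<close>
  define \<xi> where "\<xi> k = e k + \<delta> k * (norm (D k))\<^sup>2" for k
  \<comment> \<open>\<open>K\<close> compares the energy with its loss over two steps; solving
    \<open>\<xi> (k + 2) \<le> K * (\<xi> k - \<xi> (k + 2))\<close> gives the ratio
    \<open>q\<close>.\<close>
  define K where "K = (2 * C\<^sup>2 / \<nu> + \<delta> 0) / \<eta>"
  define q where "q = K / (1 + K)"
  have "C > 0" using L_pos \<gamma>_pos[of 0] by (simp add: C_def add_pos_pos)
  then have "K > 0"
    using \<nu>_pos \<eta>_pos \<delta>_nonneg[of 0] unfolding K_def
    by (intro divide_pos_pos add_pos_nonneg) auto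
  then have q: "0 < q" "q < 1" by (simp_all add: q_def)
  have e_le: "e k \<le> \<xi> k" for k using \<delta>_nonneg by (simp add: \<xi>_def)
  have \<xi>_nonneg: "\<xi> k \<ge> 0" if "k \<ge> 2" for k
    using e_le[of k] e_nonneg[OF that] by linarith
  have decrease: "\<xi> (Suc k) + \<eta> * (norm (D (Suc k)))\<^sup>2 \<le> \<xi> k" if "k \<ge> 2" for k
  proof -
    have "\<delta> (Suc k) * (norm (D (Suc k)))\<^sup>2 \<le> \<delta> k * (norm (D (Suc k)))\<^sup>2"
      using \<delta>_Suc by (intro mult_right_mono) auto
    then show ?thesis using descent[OF that] by (simp add: \<xi>_def algebra_simps)
  qed
  \<comment> \<open>Two steps are needed because \<open>gap\<close> at \<open>Suc k\<close> involves
    both \<open>D (Suc k)\<close> and \<open>D (k + 2)\<close>, whose squares are paid for by the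
    decreases at \<open>k\<close> and at \<open>Suc k\<close>.\<close>
  have "\<xi> (k + 2) \<le> q * \<xi> k" if k: "k \<ge> 2" for k
  proof -
    let ?n = "norm (D (Suc k))" and ?n' = "norm (D (Suc (Suc k)))"
    have "\<delta> (k + 2) * ?n'\<^sup>2 \<le> \<delta> 0 * (?n\<^sup>2 + ?n'\<^sup>2)"
      using \<delta>_0 \<delta>_nonneg by (intro mult_mono) auto
    with gap[of "Suc k"] have "\<xi> (k + 2) \<le> (2 * C\<^sup>2 / \<nu> + \<delta> 0) * (?n\<^sup>2 + ?n'\<^sup>2)"
      by (simp add: \<xi>_def distrib_right)
    also have "\<dots> = K * (\<eta> * (?n\<^sup>2 + ?n'\<^sup>2))" using \<eta>_pos by (simp add: K_def)
    also have "\<dots> \<le> K * (\<xi> k - \<xi> (k + 2))"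
      using decrease[of k] decrease[of "Suc k"] k \<open>K > 0\<close>
      by (intro mult_left_mono) (auto simp: algebra_simps)
    finally show ?thesis using \<open>K > 0\<close> by (simp add: q_def field_simps)
  qed
  from two_step_linear_rate[where a = \<xi>, OF q(1) \<xi>_nonneg this]
  have "\<xi> \<in> O(\<lambda>k. sqrt q ^ k)" .
  moreover have "e \<in> O(\<xi>)"
  proof (rule bigoI[where c = 1])
    show "eventually (\<lambda>k. norm (e k) \<le> 1 * norm (\<xi> k)) sequentially"
      using e_le e_nonneg \<xi>_nonneg by (intro eventually_sequentiallyI[of 2]) auto
  qed
  ultimately have "e \<in> O(\<lambda>k. sqrt q ^ k)" by (rule landau_o.big_trans[rotated])
  moreover have "eventually (\<lambda>k. \<bar>F (x k)\<bar> \<noteq> \<infinity>) sequentially"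
    by (intro eventually_sequentiallyI[of 2]) (simp add: F_x)
  moreover have "sqrt q \<in> {0<..<1}" using q by simp
  ultimately show ?thesis unfolding e_def by blast
qed

end
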